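(* Let $a,b,c>0$ be real numbers with $c\ge a+b$, let $p\in\mathbb{R}$, and let $\mathcal{F}_p(x)=(1-x)^pF(a,b;c;x)$ for $x\in(0,1)$. Put $$p_*=\frac12+\frac{ab}{c}-\sqrt{\frac14+\frac{ab(c-a)(c-b)}{c^2(c+1)}},\qquad p^*=\frac12+\frac{ab}{c}+\sqrt{\frac14+\frac{ab(c-a)(c-b)}{c^2(c+1)}}.$$ Then: (i) $-\mathcal{F}_p'$ is absolutely monotonic on $(0,1)$ if and only if $\frac{ab}{c}\le p\le 1$; (ii) $-\mathcal{F}_p''$ is absolutely monotonic on $(0,1)$ if and only if $p_*\le p\le 1$; (iii) if $p^*\le p\le 2$, then $\mathcal{F}_p''$ is absolutely monotonic on $(0,1)$.
   Context: $F(a,b;c;x)=\sum_{n=0}^\infty\frac{(a)_n(b)_n}{(c)_n}\frac{x^n}{n!}$ is the Gaussian hypergeometric function, with $(a)_0=1$ and $(a)_n=a(a+1)\cdots(a+n-1)$ for $n\ge1$. A function $f$ is absolutely monotonic on an interval $I$ if all derivatives $f^{(k)}$ exist on $I$ and $f^{(k)}(x)\ge0$ for all $x\in I$ and all integers $k\ge0$. *)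

theory Defs
  imports "HOL-Analysis.Analysis"
begin

definition hyp2F1 :: "real \<Rightarrow> real \<Rightarrow> real \<Rightarrow> real \<Rightarrow> real" where
  "hyp2F1 a b c x =
     (\<Sum>n. pochhammer a n * pochhammer b n / pochhammer c n * (x ^ n / fact n))"

definition calF :: "real \<Rightarrow> real \<Rightarrow> real \<Rightarrow> real \<Rightarrow> real \<Rightarrow> real" where
  "calF a b c p x = (1 - x) powr p * hyp2F1 a b c x"

definition p_lower :: "real \<Rightarrow> real \<Rightarrow> real \<Rightarrow> real" where
  "p_lower a b c =
     1/2 + a*b/c - sqrt (1/4 + a*b*(c - a)*(c - b) / (c\<^sup>2 * (c + 1)))"

definition p_upper :: "real \<Rightarrow> real \<Rightarrow> real \<Rightarrow> real" where
  "p_upper a b c =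
     1/2 + a*b/c + sqrt (1/4 + a*b*(c - a)*(c - b) / (c\<^sup>2 * (c + 1)))"

text \<open>\<open>D k\<close> is the \<open>k\<close>-th derivative of \<open>f\<close> on \<open>I\<close>. Derivatives are taken within
  \<open>I\<close>, hence one-sided at an endpoint belonging to \<open>I\<close>; on a nondegenerate interval
  they are unique, so the choice of \<open>D\<close> is forced there.\<close>

definition absolutely_monotonic_on :: "real set \<Rightarrow> (real \<Rightarrow> real) \<Rightarrow> bool" where
  "absolutely_monotonic_on I f \<longleftrightarrow>
     (\<exists>D :: nat \<Rightarrow> real \<Rightarrow> real.
        (\<forall>x\<in>I. D 0 x = f x) \<and>
        (\<forall>k. \<forall>x\<in>I. (D k has_real_derivative D (Suc k) x) (at x within I)) \<and>
        (\<forall>k. \<forall>x\<in>I. 0 \<le> D k x))"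

lemma absolutely_monotonic_on_open_iff:
  assumes "open I"
  shows "absolutely_monotonic_on I f \<longleftrightarrow>
    (\<forall>k. \<forall>x\<in>I. (deriv ^^ k) f differentiable at x \<and> 0 \<le> (deriv ^^ k) f x)"
    (is "_ = ?R")
proof
  assume "absolutely_monotonic_on I f"
  then obtain D where D0: "\<And>x. x \<in> I \<Longrightarrow> D 0 x = f x"
    and DS: "\<And>k x. x \<in> I \<Longrightarrow> (D k has_real_derivative D (Suc k) x) (at x within I)"
    and nonneg: "\<And>k x. x \<in> I \<Longrightarrow> 0 \<le> D k x"
    unfolding absolutely_monotonic_on_def by blast
  have transfer: "(g has_real_derivative D (Suc k) x) (at x)"
    if "\<And>y. y \<in> I \<Longrightarrow> D k y = g y" "x \<in> I" for g k x
  proof -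
    have "(D k has_real_derivative D (Suc k) x) (at x)"
      using DS[OF that(2), of k] at_within_open[OF that(2) assms] by simp
    then show ?thesis
      by (rule has_field_derivative_transform_within_open[OF _ assms]) (use that in auto)
  qed
  have eq: "\<forall>x\<in>I. D k x = (deriv ^^ k) f x" for k
  proof (induction k)
    case 0
    then show ?case by (simp add: D0)
  next
    case (Suc k)
    then show ?case using transfer[of k "(deriv ^^ k) f"]
      by (auto intro: DERIV_imp_deriv[symmetric])
  qed
  show ?R
  proof (intro allI ballI conjI)
    fix k x assume "x \<in> I"
    then show "(deriv ^^ k) f differentiable at x"
      using transfer[of k "(deriv ^^ k) f" x] eq by (auto simp: real_differentiable_def)
    show "0 \<le> (deriv ^^ k) f x"
      using eq nonneg \<open>x \<in> I\<close> by metis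
  qed
next
  assume R: ?R
  show "absolutely_monotonic_on I f"
    unfolding absolutely_monotonic_on_def
  proof (intro exI[of _ "\<lambda>k. (deriv ^^ k) f"] conjI allI ballI)
    fix k x assume "x \<in> I"
    with R have "(deriv ^^ k) f differentiable at x" by blast
    then show "((deriv ^^ k) f has_real_derivative (deriv ^^ Suc k) f x) (at x within I)"
      by (auto simp: real_differentiable_def DERIV_imp_deriv
          intro: has_field_derivative_at_within)
  qed (use R in auto)
qed

end

theory Submission
  imports Defs "HOL-Real_Asymp.Real_Asymp"
begin

text \<open>
  Let \<open>u\<^sub>n\<close> be the coefficients of \<open>y = (1 - x)\<^sup>p F(a,b;c;x)\<close> at \<open>0\<close>. A power series is absolutely
  monotonic on \<open>(0,1)\<close> as soon as its coefficients are nonnegative, so each of the three sufficiency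
  claims says that \<open>u\<^sub>n\<close> has one sign from some index on (\<open>1\<close> in the first claim, \<open>2\<close> in the
  others). For the first of these coefficients, the lower bound on \<open>p\<close> provides this sign:
  \<open>u\<^sub>1 = ab/c - p\<close>, and \<open>2u\<^sub>2\<close> is the monic quadratic in \<open>p\<close> with roots \<open>p\<^sub>*\<close> and \<open>p\<^sup>*\<close>
  (\<open>calF_fps_2\<close>), where \<open>p\<^sub>* > 0\<close> and \<open>p\<^sup>* > 1\<close>.

  The sign is propagated by comparison with the coefficients \<open>Y\<^sub>n\<close> of
  \<open>Y = (1 - x)\<^sup>p\<^sup>-\<^sup>1 F(a,b;c+1;x)\<close>. The contiguous relations
  \<open>c F(c) = c F(c+1) + x F'(c+1)\<close> and \<open>c((1 - x) F'(c) + (c-a-b) F(c)) = (c-a)(c-b) F(c+1)\<close>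
  give two first-order relations between \<open>u\<close> and \<open>Y\<close>, and eliminating \<open>Y\<^sub>n\<close> yields
  \<open>c (n+c)(n+1) u\<^sub>n\<^sub>+\<^sub>1 = B c u\<^sub>n - p (c-a)(c-b) Y\<^sub>n\<^sub>-\<^sub>1\<close> with \<open>B = (n+a)(n+b) - p(n+c)\<close>.
  If \<open>u\<^sub>n\<close> and \<open>Y\<^sub>n\<^sub>-\<^sub>1\<close> have opposite signs and \<open>B \<ge> 0\<close>, then \<open>u\<^sub>n\<^sub>+\<^sub>1\<close> inherits the sign of
  \<open>u\<^sub>n\<close>; if \<open>B < 0\<close>, expressing \<open>u\<^sub>n\<close> through \<open>Y\<close> gives the same conclusion
  (\<open>contiguous_sign_step\<close>). For \<open>0 \<le> p \<le> 1\<close> the exponent \<open>p - 1\<close> of \<open>Y\<close> is nonpositive, so that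
  \<open>Y\<^sub>n \<ge> 0\<close> is clear, and \<open>u\<close> stays nonpositive once it is so at some index \<open>n \<ge> 1\<close>. For \<open>p\<^sup>* \<le> p \<le> 2\<close> the signs are
  reversed: \<open>p \<ge> p\<^sup>* \<ge> 1 + ab/c\<close>, so the case just settled, applied to \<open>p - 1\<close> and \<open>c + 1\<close>,
  gives \<open>Y\<^sub>n \<le> 0\<close> for \<open>n \<ge> 1\<close>.

  Conversely, absolute monotonicity of \<open>-y'\<close> or \<open>-y''\<close> gives the sign of \<open>u\<^sub>1\<close> or \<open>u\<^sub>2\<close> by letting
  \<open>x \<rightarrow> 0\<close>. It also makes \<open>y\<close> concave; as \<open>y \<ge> 0\<close> and \<open>y(0) = 1\<close>, this forces \<open>y \<ge> 1 - x\<close>. Since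
  \<open>c \<ge> a + b\<close>, the function \<open>F\<close> grows more slowly at \<open>1\<close> than every negative power of \<open>1 - x\<close>, so
  \<open>y \<ge> 1 - x\<close> is impossible for \<open>p > 1\<close> (\<open>concave_calF_imp_exponent_le_1\<close>). Once \<open>p \<le> 1 < p\<^sup>*\<close> is known,
  \<open>u\<^sub>2 \<le> 0\<close> means \<open>p \<ge> p\<^sub>*\<close>.
\<close>

section \<open>The power series of the function\<close>

text \<open>The series of \<open>(1 - x)\<^sup>p\<close>. Compared with \<open>fps_binomial\<close>, the variable is negated; rising
  factorials make the signs of the coefficients visible.\<close>

definition binomial_fps :: "real \<Rightarrow> real fps" where
  "binomial_fps p = Abs_fps (\<lambda>n. pochhammer (- p) n / fact n)"

definition hyp_fps :: "real \<Rightarrow> real \<Rightarrow> real \<Rightarrow> real fps" where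
  "hyp_fps a b c = Abs_fps (\<lambda>n. pochhammer a n * pochhammer b n / (pochhammer c n * fact n))"

definition calF_fps :: "real \<Rightarrow> real \<Rightarrow> real \<Rightarrow> real \<Rightarrow> real fps" where
  "calF_fps a b c p = binomial_fps p * hyp_fps a b c"

lemma binomial_fps_sums:
  assumes "\<bar>x\<bar> < 1"
  shows "(\<lambda>n. fps_nth (binomial_fps p) n * x ^ n) sums ((1 - x) powr p)"
proof -
  have "(p gchoose n) * (- x) ^ n = fps_nth (binomial_fps p) n * x ^ n" for n
    by (cases "even n") (simp_all add: binomial_fps_def gbinomial_pochhammer)
  then show ?thesis
    using gen_binomial_real[of "- x" p] assms by simp
qed

lemma binomial_fps_conv_radius: "fps_conv_radius (binomial_fps p) \<ge> 1"
  unfolding fps_conv_radius_def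
proof (rule conv_radius_geI_ex')
  fix r :: real
  assume "0 < r" "ereal r < 1"
  then show "summable (\<lambda>n. fps_nth (binomial_fps p) n * of_real r ^ n)"
    using binomial_fps_sums[of r p] by (simp add: sums_iff)
qed

lemma hyp_fps_Suc:
  fixes a b c :: real
  assumes "c > 0"
  shows "fps_nth (hyp_fps a b c) (Suc n) * ((c + n) * (real n + 1))
    = fps_nth (hyp_fps a b c) n * ((a + n) * (b + n))"
proof -
  have "pochhammer c n > 0" "pochhammer c (Suc n) > 0"
    using assms by (simp_all add: pochhammer_pos)
  then show ?thesis
    using assms by (simp add: hyp_fps_def pochhammer_rec' divide_simps)
qed

lemma hyp_fps_pos:
  assumes "a > 0" "b > 0" "c > 0"
  shows "fps_nth (hyp_fps a b c) n > 0"
  using assms by (simp add: hyp_fps_def pochhammer_pos)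

lemma hyp_fps_conv_radius:
  assumes "a > 0" "b > 0" "c > 0"
  shows "fps_conv_radius (hyp_fps a b c) \<ge> 1"
proof -
  let ?t = "fps_nth (hyp_fps a b c)"
  have "norm (?t n) / norm (?t (Suc n)) = (c + n) * (n + 1) / ((a + n) * (b + n))" for n
    using hyp_fps_Suc[OF assms(3), of a b n] hyp_fps_pos[OF assms, of n]
      hyp_fps_pos[OF assms, of "Suc n"] assms
    by (simp add: divide_simps add_pos_nonneg) (auto simp: algebra_simps)
  moreover have "(\<lambda>n. (c + real n) * (real n + 1) / ((a + real n) * (b + real n))) \<longlonglongrightarrow> 1"
    by real_asymp
  ultimately have "(\<lambda>n. norm (?t n) / norm (?t (Suc n))) \<longlonglongrightarrow> 1"
    by (simp add: add.commute)
  then have "conv_radius ?t = 1"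
    by (intro conv_radius_ratio_limit_nonzero[of _ 1]) (auto simp: one_ereal_def)
  then show ?thesis
    by (simp add: fps_conv_radius_def)
qed

lemma calF_fps_conv_radius:
  assumes "a > 0" "b > 0" "c > 0"
  shows "fps_conv_radius (calF_fps a b c p) \<ge> 1"
  using fps_conv_radius_mult[of "binomial_fps p" "hyp_fps a b c"]
    binomial_fps_conv_radius[of p] hyp_fps_conv_radius[OF assms]
  unfolding calF_fps_def by (meson min.boundedI order_trans)

lemma eval_binomial_fps: "\<bar>x\<bar> < 1 \<Longrightarrow> eval_fps (binomial_fps p) x = (1 - x) powr p"
  using binomial_fps_sums[of x p] by (simp add: eval_fps_def sums_iff)

lemma eval_hyp_fps: "eval_fps (hyp_fps a b c) x = hyp2F1 a b c x"
  by (simp add: eval_fps_def hyp_fps_def hyp2F1_def)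

lemma fps_conv_radius_ge_1D:
  assumes "fps_conv_radius A \<ge> 1" "\<bar>x :: real\<bar> < 1"
  shows "ereal (norm x) < fps_conv_radius A"
  using assms by (auto simp: one_ereal_def elim: less_le_trans[rotated])

lemma eval_calF_fps:
  assumes "a > 0" "b > 0" "c > 0" "\<bar>x\<bar> < 1"
  shows "eval_fps (calF_fps a b c p) x = calF a b c p x"
proof -
  have "eval_fps (calF_fps a b c p) x
      = eval_fps (binomial_fps p) x * eval_fps (hyp_fps a b c) x"
    unfolding calF_fps_def using binomial_fps_conv_radius[of p] hyp_fps_conv_radius[OF assms(1-3)]
    by (intro eval_fps_mult fps_conv_radius_ge_1D assms)
  then show ?thesis
    by (simp add: calF_def eval_hyp_fps eval_binomial_fps assms)
qed

section \<open>Two contiguous relations and the sign of the coefficients\<close>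

lemma binomial_fps_lower: "(1 - fps_X) * binomial_fps (p - 1) = binomial_fps p"
proof (rule fps_ext)
  fix n
  show "fps_nth ((1 - fps_X) * binomial_fps (p - 1)) n = fps_nth (binomial_fps p) n"
  proof (cases n)
    case (Suc k)
    have "pochhammer (- p) (Suc k) = - p * pochhammer (1 - p) k"
      by (simp add: pochhammer_rec)
    then show ?thesis
      using Suc by (simp add: binomial_fps_def left_diff_distrib pochhammer_rec'[of "1 - p"] divide_simps)
        (simp add: algebra_simps)
  qed (simp add: binomial_fps_def left_diff_distrib)
qed

lemma binomial_fps_Suc:
  "(real n + 1) * fps_nth (binomial_fps p) (Suc n) = (real n - p) * fps_nth (binomial_fps p) n"
  by (simp add: binomial_fps_def pochhammer_rec' divide_simps)

lemma fps_nth_1_minus_X_deriv: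
  fixes f :: "real fps"
  shows "fps_nth ((1 - fps_X) * fps_deriv f) n = (real n + 1) * fps_nth f (Suc n) - real n * fps_nth f n"
  by (cases n) (simp_all add: left_diff_distrib algebra_simps)

lemma fps_nth_1_minus_X_Suc:
  fixes f :: "real fps"
  shows "fps_nth ((1 - fps_X) * f) (Suc n) = fps_nth f (Suc n) - fps_nth f n"
  by (simp add: left_diff_distrib)

lemma fps_deriv_binomial_fps:
  "(1 - fps_X) * fps_deriv (binomial_fps p) = fps_const (- p) * binomial_fps p"
  by (rule fps_ext) (simp only: fps_nth_1_minus_X_deriv binomial_fps_Suc, simp add: algebra_simps)

lemma hyp_fps_Suc_param:
  fixes a b c :: real
  assumes "c > 0"
  shows "(c + n) * fps_nth (hyp_fps a b (c + 1)) n = c * fps_nth (hyp_fps a b c) n"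
proof -
  have "pochhammer c n * (c + n) = c * pochhammer (c + 1) n"
    using pochhammer_rec[of c n] pochhammer_rec'[of c n] by (simp add: mult.commute)
  moreover have "pochhammer c n > 0" "pochhammer (c + 1) n > 0"
    using assms by (simp_all add: pochhammer_pos)
  ultimately show ?thesis
    by (simp add: hyp_fps_def divide_simps) (simp add: algebra_simps)
qed

text \<open>Multiplying the \<open>n\<close>-th coefficient of \<open>F(a,b;c+1;x)\<close> by \<open>c + n\<close> is applying \<open>c + x d/dx\<close>.\<close>

lemma hyp_fps_raise:
  fixes a b c :: real
  assumes "c > 0"
  shows "fps_const c * hyp_fps a b c
    = fps_const c * hyp_fps a b (c + 1) + fps_X * fps_deriv (hyp_fps a b (c + 1))"
proof (rule fps_ext)
  fix n
  show "fps_nth (fps_const c * hyp_fps a b c) n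
    = fps_nth (fps_const c * hyp_fps a b (c + 1) + fps_X * fps_deriv (hyp_fps a b (c + 1))) n"
    using hyp_fps_Suc_param[OF assms, of n a b, symmetric]
    by (cases n) (simp_all add: algebra_simps)
qed

text \<open>This is the formula for the derivative of \<open>(1 - x)\<^sup>a\<^sup>+\<^sup>b\<^sup>-\<^sup>c F(a,b;c;x)\<close>. On coefficients it
  comes down to \<open>(n+a)(n+b) + (n+c)(c-a-b-n) = (c-a)(c-b)\<close>.\<close>

lemma hyp_fps_deriv:
  fixes a b c :: real
  assumes "c > 0"
  shows "fps_const c * ((1 - fps_X) * fps_deriv (hyp_fps a b c) + fps_const (c - a - b) * hyp_fps a b c)
    = fps_const ((c - a) * (c - b)) * hyp_fps a b (c + 1)"
proof (rule fps_ext)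
  fix n
  let ?t = "fps_nth (hyp_fps a b c)" and ?s = "fps_nth (hyp_fps a b (c + 1))"
  have "(c + n) * (c * ((real n + 1) * ?t (Suc n) - n * ?t n + (c - a - b) * ?t n))
      = c * (?t n * ((a + n) * (b + n)) + (c + n) * (c - a - b - n) * ?t n)"
    using hyp_fps_Suc[OF assms, of a b n] by algebra
  also have "\<dots> = (c - a) * (c - b) * (c * ?t n)"
    by algebra
  also have "\<dots> = (c + n) * ((c - a) * (c - b) * ?s n)"
    by (simp add: hyp_fps_Suc_param[OF assms, symmetric])
  finally have "c * ((real n + 1) * ?t (Suc n) - n * ?t n + (c - a - b) * ?t n) = (c - a) * (c - b) * ?s n"
    using assms by (simp add: add_pos_nonneg mult_cancel_left)
  then show "fps_nth (fps_const c * ((1 - fps_X) * fps_deriv (hyp_fps a b c)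
        + fps_const (c - a - b) * hyp_fps a b c)) n
      = fps_nth (fps_const ((c - a) * (c - b)) * hyp_fps a b (c + 1)) n"
    by (simp add: fps_nth_1_minus_X_deriv)
qed

text \<open>This is \<open>hyp_fps_raise\<close> multiplied by \<open>(1 - x)\<^sup>p\<close>; the product rule for
  \<open>(1 - x)\<^sup>p\<^sup>-\<^sup>1 F(a,b;c+1;x)\<close> removes the derivative of \<open>F(a,b;c+1;x)\<close>.\<close>

lemma calF_fps_contiguous_lower:
  fixes a b c p :: real
  assumes "c > 0"
  shows "c * fps_nth (calF_fps a b c p) (Suc n)
    = (Suc n + c) * fps_nth (calF_fps a b (c + 1) (p - 1)) (Suc n)
      - (Suc n + c - p) * fps_nth (calF_fps a b (c + 1) (p - 1)) n"
proof -
  define E G Y where "E = binomial_fps (p - 1)" and "G = hyp_fps a b (c + 1)" and "Y = E * G"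
  have E: "(1 - fps_X) * fps_deriv E = fps_const (1 - p) * E"
    unfolding E_def using fps_deriv_binomial_fps[of "p - 1"] by simp
  have "fps_const c * calF_fps a b c p = (1 - fps_X) * E * (fps_const c * hyp_fps a b c)"
    by (simp add: calF_fps_def E_def binomial_fps_lower mult_ac)
  also have "\<dots> = (1 - fps_X) * E * (fps_const c * G + fps_X * fps_deriv G)"
    by (simp only: hyp_fps_raise[OF assms] G_def)
  also have "\<dots> = fps_const c * ((1 - fps_X) * Y) + fps_X * ((1 - fps_X) * fps_deriv Y)
      - fps_X * ((1 - fps_X) * fps_deriv E * G)"
    by (simp add: Y_def algebra_simps)
  also have "\<dots> = fps_const c * ((1 - fps_X) * Y) + fps_X * ((1 - fps_X) * fps_deriv Y)
      - fps_X * (fps_const (1 - p) * Y)"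
    by (simp only: E Y_def mult.assoc)
  finally have "fps_nth (fps_const c * calF_fps a b c p) (Suc n) = fps_nth \<dots> (Suc n)"
    by simp
  then have "c * fps_nth (calF_fps a b c p) (Suc n)
    = (Suc n + c) * fps_nth Y (Suc n) - (Suc n + c - p) * fps_nth Y n"
    by (cases n) (simp_all add: left_diff_distrib algebra_simps)
  then show ?thesis
    by (simp add: Y_def E_def G_def calF_fps_def)
qed

text \<open>In the same way, this is \<open>hyp_fps_deriv\<close> multiplied by \<open>(1 - x)\<^sup>p\<close>.\<close>

lemma calF_fps_contiguous_deriv:
  fixes a b c p :: real
  assumes "c > 0"
  shows "c * ((real (Suc n) + 1) * fps_nth (calF_fps a b c p) (Suc (Suc n))
        - (Suc n - p - (c - a - b)) * fps_nth (calF_fps a b c p) (Suc n))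
    = (c - a) * (c - b) * (fps_nth (calF_fps a b (c + 1) (p - 1)) (Suc n)
        - fps_nth (calF_fps a b (c + 1) (p - 1)) n)"
proof -
  define E F G where "E = binomial_fps p" and "F = hyp_fps a b c" and "G = hyp_fps a b (c + 1)"
  define y Y where "y = E * F" and "Y = binomial_fps (p - 1) * G"
  have E: "(1 - fps_X) * fps_deriv E = fps_const (- p) * E"
    unfolding E_def by (rule fps_deriv_binomial_fps)
  have "(1 - fps_X) * fps_deriv y = (1 - fps_X) * fps_deriv E * F + E * ((1 - fps_X) * fps_deriv F)"
    by (simp add: y_def algebra_simps)
  then have "(1 - fps_X) * fps_deriv y - fps_const (- p) * y = E * ((1 - fps_X) * fps_deriv F)"
    by (simp only: E y_def mult.assoc) simp
  then have "fps_const c * ((1 - fps_X) * fps_deriv y - fps_const (- p) * y + fps_const (c - a - b) * y)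
      = E * (fps_const c * ((1 - fps_X) * fps_deriv F + fps_const (c - a - b) * F))"
    by (simp only: y_def ring_distribs mult_ac)
  also have "\<dots> = E * (fps_const ((c - a) * (c - b)) * G)"
    by (simp only: hyp_fps_deriv[OF assms] F_def G_def)
  also have "\<dots> = fps_const ((c - a) * (c - b)) * ((1 - fps_X) * Y)"
    by (simp only: E_def Y_def binomial_fps_lower[of p, symmetric] mult_ac)
  finally have "fps_nth (fps_const c * ((1 - fps_X) * fps_deriv y - fps_const (- p) * y
      + fps_const (c - a - b) * y)) (Suc n) = fps_nth \<dots> (Suc n)"
    by simp
  then have "c * ((real (Suc n) + 1) * fps_nth y (Suc (Suc n)) - real (Suc n) * fps_nth y (Suc n)
        + p * fps_nth y (Suc n) + (c - a - b) * fps_nth y (Suc n))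
      = (c - a) * (c - b) * (fps_nth Y (Suc n) - fps_nth Y n)"
    by (simp add: fps_nth_1_minus_X_deriv fps_nth_1_minus_X_Suc)
  then have "c * ((real (Suc n) + 1) * fps_nth y (Suc (Suc n))
        - (real (Suc n) - p - (c - a - b)) * fps_nth y (Suc n))
      = (c - a) * (c - b) * (fps_nth Y (Suc n) - fps_nth Y n)"
    by algebra
  then show ?thesis
    by (simp only: y_def Y_def E_def F_def G_def calF_fps_def)
qed

text \<open>The arithmetic core. Here \<open>u\<close>, \<open>u'\<close> are the coefficients \<open>N\<close> and \<open>N + 1\<close> of
  \<open>(1 - x)\<^sup>p F(a,b;c;x)\<close>, and \<open>Y\<close>, \<open>Y'\<close> the coefficients \<open>N - 1\<close> and \<open>N\<close> of
  \<open>(1 - x)\<^sup>p\<^sup>-\<^sup>1 F(a,b;c+1;x)\<close>. Both relations are linear, so the step also applies with all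
  four numbers negated.\<close>

lemma contiguous_sign_step:
  fixes a b c p N u u' Y Y' :: real
  assumes "a > 0" "b > 0" "c > 0" "c \<ge> a + b" "0 \<le> p" "p \<le> N"
    and deriv: "c * ((N + 1) * u' - (N - p - (c - a - b)) * u) = (c - a) * (c - b) * (Y' - Y)"
    and lower: "c * u = (N + c) * Y' - (N + c - p) * Y"
    and "0 \<le> Y" "0 \<le> Y'" "u \<le> 0"
  shows "u' \<le> 0"
proof -
  define B where "B = (N + a) * (N + b) - p * (N + c)"
  have "c * (N + c) * (N + 1) * u'
      = (N + c) * (c * (N - p - (c - a - b)) * u + (c - a) * (c - b) * (Y' - Y))"
    using deriv by algebra
  also have "\<dots> = B * (c * u) - p * ((c - a) * (c - b)) * Y"
    using lower unfolding B_def by algebra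
  finally have rec: "c * (N + c) * (N + 1) * u' = B * (c * u) - p * ((c - a) * (c - b)) * Y" .
  have "c * (N + c) * (N + 1) * u' \<le> 0"
  proof (cases "B \<ge> 0")
    case True
    have "c * u \<le> 0"
      by (rule mult_nonneg_nonpos) (use \<open>c > 0\<close> \<open>u \<le> 0\<close> in auto)
    then have "B * (c * u) \<le> 0"
      by (rule mult_nonneg_nonpos[OF True])
    moreover have "0 \<le> p * ((c - a) * (c - b)) * Y"
      using assms by (intro mult_nonneg_nonneg) auto
    ultimately show ?thesis
      using rec by linarith
  next
    case False
    \<comment> \<open>Substituting \<open>lower\<close> for \<open>u\<close> turns the coefficient of \<open>Y\<close> into
      \<open>-(B(N + c - p) + p(c - a)(c - b))\<close>, which factors.\<close>
    have "c * (N + c) * (N + 1) * u'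
        = B * ((N + c) * Y') - (N + c) * ((N + a - p) * (N + b - p)) * Y"
      unfolding rec lower unfolding B_def by algebra
    moreover have "B * ((N + c) * Y') \<le> 0" "0 \<le> (N + c) * ((N + a - p) * (N + b - p)) * Y"
      using False assms by (auto intro!: mult_nonneg_nonneg mult_nonpos_nonneg)
    ultimately show ?thesis
      by linarith
  qed
  moreover have "c * (N + c) * (N + 1) > 0"
    using assms by simp
  ultimately show ?thesis
    by (meson mult_pos_pos not_le)
qed

lemma calF_fps_nonneg:
  assumes "a > 0" "b > 0" "c > 0" "p \<le> 0"
  shows "fps_nth (calF_fps a b c p) n \<ge> 0"
proof -
  have "pochhammer (- p) k \<ge> 0" for k
    using assms by (induction k) (auto simp: pochhammer_Suc)
  then show ?thesis
    unfolding calF_fps_def fps_mult_nth using hyp_fps_pos[OF assms(1-3)]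
    by (intro sum_nonneg mult_nonneg_nonneg) (auto simp: binomial_fps_def less_imp_le)
qed

lemma calF_fps_nonpos_step:
  assumes "a > 0" "b > 0" "c > 0" "c \<ge> a + b" "0 \<le> p" "p \<le> 1"
    and "fps_nth (calF_fps a b c p) (Suc n) \<le> 0"
  shows "fps_nth (calF_fps a b c p) (Suc (Suc n)) \<le> 0"
  using assms calF_fps_nonneg[of a b "c + 1" "p - 1"]
  by (intro contiguous_sign_step[OF _ _ _ _ _ _
        calF_fps_contiguous_deriv calF_fps_contiguous_lower, of a b c p n]) auto

lemma calF_fps_nonpos:
  assumes "a > 0" "b > 0" "c > 0" "c \<ge> a + b" "0 \<le> p" "p \<le> 1"
    and "fps_nth (calF_fps a b c p) (Suc n) \<le> 0" "Suc n \<le> k"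
  shows "fps_nth (calF_fps a b c p) k \<le> 0"
  using assms(8)
proof (induction k rule: dec_induct)
  case (step k)
  then show ?case
    using calF_fps_nonpos_step[OF assms(1-6), of "k - 1"] by simp
qed (use assms in simp)

lemma calF_fps_0 [simp]: "fps_nth (calF_fps a b c p) 0 = 1"
  by (simp add: calF_fps_def binomial_fps_def hyp_fps_def)

lemma calF_fps_1: "fps_nth (calF_fps a b c p) (Suc 0) = a * b / c - p"
  by (simp add: calF_fps_def binomial_fps_def hyp_fps_def fps_mult_nth)

lemma calF_fps_2:
  assumes "a > 0" "b > 0" "c > 0" "c \<ge> a + b"
  shows "2 * fps_nth (calF_fps a b c p) 2 = (p - p_lower a b c) * (p - p_upper a b c)"
proof -
  define s where "s = sqrt (1/4 + a*b*(c - a)*(c - b) / (c\<^sup>2 * (c + 1)))"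
  have s: "s\<^sup>2 = 1/4 + a*b*(c - a)*(c - b) / (c\<^sup>2 * (c + 1))"
    unfolding s_def using assms by (intro real_sqrt_pow2) auto
  have "(p - (h + q - s)) * (p - (h + q + s)) = (p - h - q)\<^sup>2 - s\<^sup>2" for h q
    by algebra
  then have "(p - p_lower a b c) * (p - p_upper a b c) = (p - 1/2 - a*b/c)\<^sup>2 - s\<^sup>2"
    unfolding p_lower_def p_upper_def s_def[symmetric] .
  also have "\<dots> = p * (p - 1) - 2 * p * (a * b / c) + a * (a + 1) * (b * (b + 1)) / (c * (c + 1))"
    unfolding s using assms
    by (simp add: divide_simps) (simp add: power2_eq_square algebra_simps)
  also have "\<dots> = 2 * fps_nth (calF_fps a b c p) 2"
    using assms
    by (simp add: calF_fps_def binomial_fps_def hyp_fps_def fps_mult_nth numeral_2_eq_2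
        pochhammer_Suc divide_simps) (simp add: algebra_simps)
  finally show ?thesis by simp
qed

lemma p_lower_upper_bounds:
  assumes "a > 0" "b > 0" "c > 0" "c \<ge> a + b"
  shows "0 < p_lower a b c" "1 + a * b / c \<le> p_upper a b c"
proof -
  have "sqrt ((1/2)\<^sup>2) \<le> sqrt (1/4 + a*b*(c - a)*(c - b) / (c\<^sup>2 * (c + 1)))"
    using assms by (intro real_sqrt_le_mono) (simp add: power2_eq_square)
  then show upper: "1 + a * b / c \<le> p_upper a b c"
    by (simp add: p_upper_def)
  have "p_lower a b c * p_upper a b c = 2 * fps_nth (calF_fps a b c 0) 2"
    using calF_fps_2[OF assms, of 0] by simp
  also have "\<dots> > 0"
    using assms
    by (simp add: calF_fps_def binomial_fps_def hyp_fps_def fps_mult_nth numeral_2_eq_2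
        pochhammer_Suc)
  finally show "0 < p_lower a b c"
    using upper assms by (simp add: zero_less_mult_iff) (smt (verit) divide_pos_pos mult_pos_pos)
qed

text \<open>Here \<open>contiguous_sign_step\<close> is applied to the negated coefficients. Its premise \<open>p \<le> N\<close> holds
  because the induction starts at \<open>N = 2\<close>.\<close>

lemma calF_fps_nonneg_from_2:
  assumes "a > 0" "b > 0" "c > 0" "c \<ge> a + b" "p_upper a b c \<le> p" "p \<le> 2" "2 \<le> k"
  shows "fps_nth (calF_fps a b c p) k \<ge> 0"
  using assms(7)
proof (induction k rule: dec_induct)
  case base
  have "p_lower a b c \<le> p_upper a b c"
    using assms by (simp add: p_lower_def p_upper_def)
  then have "2 * fps_nth (calF_fps a b c p) 2 \<ge> 0"
    using assms by (simp add: calF_fps_2)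
  then show ?case by simp
next
  case (step k)
  then obtain n where k: "k = Suc n" "n \<ge> 1"
    by (cases k) auto
  have p: "1 + a * b / c \<le> p"
    using p_lower_upper_bounds[OF assms(1-4)] assms by simp
  have "a * b / (c + 1) \<le> a * b / c"
    using assms by (simp add: frac_le)
  then have "fps_nth (calF_fps a b (c + 1) (p - 1)) (Suc 0) \<le> 0"
    using p by (simp add: calF_fps_1)
  moreover have ab: "0 < a * b / c"
    using assms by simp
  then have "1 \<le> p"
    using p by linarith
  ultimately have Y_nonpos: "fps_nth (calF_fps a b (c + 1) (p - 1)) j \<le> 0" if "j \<ge> 1" for j
    using calF_fps_nonpos[of a b "c + 1" "p - 1" 0 j] assms that by simp
  define u u' Y Y' where "u = fps_nth (calF_fps a b c p) (Suc n)"
    and "u' = fps_nth (calF_fps a b c p) (Suc (Suc n))"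
    and "Y = fps_nth (calF_fps a b (c + 1) (p - 1)) n"
    and "Y' = fps_nth (calF_fps a b (c + 1) (p - 1)) (Suc n)"
  have "- u' \<le> 0"
  proof (rule contiguous_sign_step[OF assms(1-4)])
    show "c * ((real (Suc n) + 1) * (- u') - (real (Suc n) - p - (c - a - b)) * (- u))
        = (c - a) * (c - b) * (- Y' - (- Y))"
      using calF_fps_contiguous_deriv[OF assms(3), of n a b p, folded u_def u'_def Y_def Y'_def]
      by algebra
    show "c * (- u) = (real (Suc n) + c) * (- Y') - (real (Suc n) + c - p) * (- Y)"
      using calF_fps_contiguous_lower[OF assms(3), of a b p n, folded u_def Y_def Y'_def]
      by algebra
  qed (use assms step.IH k Y_nonpos[of n] Y_nonpos[of "Suc n"] \<open>1 \<le> p\<close> in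
      \<open>simp_all add: u_def Y_def Y'_def\<close>)
  then show ?case
    using k by (simp add: u'_def)
qed

section \<open>Absolute monotonicity of a power series\<close>

lemma fps_conv_radius_funpow_deriv:
  fixes A :: "real fps"
  shows "fps_conv_radius A \<le> fps_conv_radius ((fps_deriv ^^ k) A)"
  by (induction k) (auto intro: order_trans fps_conv_radius_deriv)

lemma absolutely_monotonic_on_eval_fps:
  assumes "fps_conv_radius A \<ge> 1" "\<And>n. fps_nth A n \<ge> 0"
  shows "absolutely_monotonic_on {0<..<1} (eval_fps A)"
  unfolding absolutely_monotonic_on_def
proof (intro exI[of _ "\<lambda>k. eval_fps ((fps_deriv ^^ k) A)"] conjI allI ballI)
  fix k and x :: real
  assume x: "x \<in> {0<..<1}"
  have rad: "ereal (norm x) < fps_conv_radius ((fps_deriv ^^ k) A)" for k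
    using x by (intro less_le_trans[OF fps_conv_radius_ge_1D[OF assms(1)] fps_conv_radius_funpow_deriv]) auto
  show "(eval_fps ((fps_deriv ^^ k) A) has_real_derivative eval_fps ((fps_deriv ^^ Suc k) A) x)
      (at x within {0<..<1})"
    using has_field_derivative_eval_fps[OF rad[of k]] by simp
  have "fps_nth ((fps_deriv ^^ k) A) n \<ge> 0" for n
    by (induction k arbitrary: n) (simp_all add: assms)
  then show "0 \<le> eval_fps ((fps_deriv ^^ k) A) x"
    unfolding eval_fps_def using x rad by (intro suminf_nonneg summable_fps) auto
qed simp

text \<open>Necessity of a sign condition on a coefficient: the boundary point \<open>0\<close> is reached by
  continuity.\<close>

lemma fps_nth_0_nonneg:
  assumes "fps_conv_radius A \<ge> 1" "\<And>x. x \<in> {0<..<1} \<Longrightarrow> 0 \<le> eval_fps A (x :: real)"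
  shows "fps_nth A 0 \<ge> 0"
proof -
  have "continuous (at_right 0) (eval_fps A)"
    using fps_conv_radius_ge_1D[OF assms(1), of 0] by (intro continuous_eval_fps) auto
  then have "(eval_fps A \<longlongrightarrow> fps_nth A 0) (at_right 0)"
    by (simp add: continuous_within eval_fps_at_0)
  moreover have "eventually (\<lambda>x. 0 \<le> eval_fps A x) (at_right 0)"
    using eventually_at_right_real[of 0 1] assms(2) by (auto elim: eventually_mono)
  ultimately show ?thesis
    by (rule tendsto_lowerbound) simp
qed

lemma funpow_deriv_eq_eval_fps:
  assumes "fps_conv_radius A \<ge> 1" "\<And>x. \<bar>x\<bar> < 1 \<Longrightarrow> f x = eval_fps A x" "\<bar>x :: real\<bar> < 1"
  shows "(deriv ^^ k) f x = eval_fps ((fps_deriv ^^ k) A) x"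
  using assms(3)
proof (induction k arbitrary: x)
  case (Suc k)
  have "(eval_fps ((fps_deriv ^^ k) A) has_real_derivative eval_fps ((fps_deriv ^^ Suc k) A) x) (at x)"
    using has_field_derivative_eval_fps[OF less_le_trans[OF
          fps_conv_radius_ge_1D[OF assms(1) Suc.prems] fps_conv_radius_funpow_deriv[of A k]]]
    by simp
  then have "((deriv ^^ k) f has_real_derivative eval_fps ((fps_deriv ^^ Suc k) A) x) (at x)"
    using Suc by (elim has_field_derivative_transform_within_open[of _ _ _ "{-1<..<1}"]) auto
  then show ?case
    by (simp add: DERIV_imp_deriv)
qed (simp add: assms)

lemma absolutely_monotonic_on_cong:
  assumes "\<And>x. x \<in> I \<Longrightarrow> f x = g x"
  shows "absolutely_monotonic_on I f \<longleftrightarrow> absolutely_monotonic_on I g"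
  using assms by (simp add: absolutely_monotonic_on_def)

section \<open>Concavity forces the exponent to be at most one\<close>

text \<open>The quotient of successive coefficients is \<open>(a+n)(b+n)/((c+n)(n+1))\<close> on the left and
  \<open>(\<eta>+n)/(n+1)\<close> on the right. Since \<open>a + b \<le> c\<close>, the former is the smaller one as soon as
  \<open>ab \<le> \<eta>n\<close>, so the quotient of the two sequences is eventually decreasing and hence bounded.\<close>

lemma hyp_fps_le_binomial_fps:
  assumes "a > 0" "b > 0" "c > 0" "c \<ge> a + b" "\<eta> > 0"
  obtains K where "\<And>n. fps_nth (hyp_fps a b c) n \<le> K * fps_nth (binomial_fps (- \<eta>)) n"
proof -
  let ?t = "fps_nth (hyp_fps a b c)" and ?e = "fps_nth (binomial_fps (- \<eta>))"
  define r where "r n = ?t n / ?e n" for n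
  have e_pos: "?e n > 0" for n
    using assms by (simp add: binomial_fps_def pochhammer_pos)
  obtain N :: nat where N: "a * b / \<eta> \<le> N"
    using real_arch_simple by blast
  have dec: "r (Suc n) \<le> r n" if "n \<ge> N" for n
  proof -
    have "a * b \<le> \<eta> * n"
      using N that assms by (simp add: divide_simps mult.commute)
      (meson mult_left_mono of_nat_le_iff order_trans less_imp_le)
    moreover have "(a + b) * n \<le> c * n" "0 \<le> c * \<eta>"
      using assms by (auto intro: mult_right_mono)
    ultimately have "(a + n) * (b + n) \<le> (c + n) * (\<eta> + n)"
      by (simp add: algebra_simps)
    then have "?t n * ((a + n) * (b + n)) \<le> ?t n * ((c + n) * (\<eta> + n))"
      using hyp_fps_pos[OF assms(1-3), of n] by (intro mult_left_mono) auto
    then have "(c + n) * (?t (Suc n) * (real n + 1)) \<le> (c + n) * (?t n * (\<eta> + n))"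
      using hyp_fps_Suc[OF assms(3), of a b n] by (simp add: mult_ac)
    then have t: "?t (Suc n) * (real n + 1) \<le> ?t n * (\<eta> + n)"
      using assms by (simp add: mult_le_cancel_left_pos add_pos_nonneg)
    have e: "?e (Suc n) * (real n + 1) = ?e n * (\<eta> + n)"
      using binomial_fps_Suc[of n "- \<eta>"] by (simp add: algebra_simps)
    have "r (Suc n) = (?t (Suc n) * (real n + 1)) / (?e (Suc n) * (real n + 1))"
      by (simp add: r_def)
    also have "\<dots> \<le> (?t n * (\<eta> + n)) / (?e n * (\<eta> + n))"
      unfolding e using t e_pos[of n] assms by (intro divide_right_mono) auto
    also have "\<dots> = r n"
      using assms by (simp add: r_def)
    finally show ?thesis .
  qed
  define K where "K = Max (r ` {..N})"
  have r_le_K: "r n \<le> K" for n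
  proof (cases "n \<le> N")
    case False
    then have "N \<le> n"
      by simp
    then have "r n \<le> r N"
      by (induction n rule: dec_induct) (auto dest: dec)
    also have "r N \<le> K"
      by (simp add: K_def)
    finally show ?thesis .
  qed (simp add: K_def)
  have "?t n \<le> K * ?e n" for n
    using r_le_K[of n] e_pos[of n] by (simp add: r_def pos_divide_le_eq)
  then show thesis
    by (rule that)
qed

text \<open>With \<open>\<eta> = (p - 1)/2\<close>, the bound \<open>F \<le> K(1 - x)\<^sup>-\<^sup>\<eta>\<close> makes \<open>(1 - x)\<^sup>p F\<close> at most
  \<open>K(1 - x)\<^sup>1\<^sup>+\<^sup>\<eta>\<close>, which is \<open>o(1 - x)\<close> at \<open>1\<close>.\<close>

lemma calF_below_chord:
  assumes "a > 0" "b > 0" "c > 0" "c \<ge> a + b" "p > 1"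
  shows "\<exists>x\<in>{0<..<1}. calF a b c p x < 1 - x"
proof -
  define \<eta> where "\<eta> = (p - 1) / 2"
  have "\<eta> > 0"
    using assms by (simp add: \<eta>_def)
  obtain K where K: "\<And>n. fps_nth (hyp_fps a b c) n \<le> K * fps_nth (binomial_fps (- \<eta>)) n"
    using hyp_fps_le_binomial_fps[OF assms(1-4) \<open>\<eta> > 0\<close>] by blast
  have bound: "hyp2F1 a b c x \<le> K * (1 - x) powr (- \<eta>)" if "0 < x" "x < 1" for x
  proof (rule sums_le)
    have x: "\<bar>x\<bar> < 1"
      using that by simp
    show "(\<lambda>n. fps_nth (hyp_fps a b c) n * x ^ n) sums hyp2F1 a b c x"
      using sums_eval_fps[OF fps_conv_radius_ge_1D[OF hyp_fps_conv_radius[OF assms(1-3)] x]]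
      by (simp add: eval_hyp_fps)
    show "(\<lambda>n. K * (fps_nth (binomial_fps (- \<eta>)) n * x ^ n)) sums (K * (1 - x) powr (- \<eta>))"
      by (intro sums_mult binomial_fps_sums x)
    show "fps_nth (hyp_fps a b c) n * x ^ n \<le> K * (fps_nth (binomial_fps (- \<eta>)) n * x ^ n)" for n
      using mult_right_mono[OF K[of n], of "x ^ n"] that by (simp add: mult_ac)
  qed
  have "((\<lambda>x. K * (1 - x) powr \<eta>) \<longlongrightarrow> 0) (at_left 1)"
    using \<open>\<eta> > 0\<close> by real_asymp
  then have "eventually (\<lambda>x. K * (1 - x) powr \<eta> < 1) (at_left 1)"
    by (rule order_tendstoD) simp
  moreover have "eventually (\<lambda>x. x \<in> {0<..<1}) (at_left (1::real))"
    by (rule eventually_at_left_real) simp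
  ultimately have "eventually (\<lambda>x. x \<in> {0<..<1} \<and> K * (1 - x) powr \<eta> < 1) (at_left 1)"
    by (rule eventually_conj[rotated])
  then obtain x where x: "x \<in> {0<..<1}" "K * (1 - x) powr \<eta> < 1"
    using eventually_happens trivial_limit_at_left_real by blast
  have "calF a b c p x \<le> (1 - x) powr p * (K * (1 - x) powr (- \<eta>))"
    unfolding calF_def using x bound[of x] by (intro mult_left_mono) auto
  also have "\<dots> = K * (1 - x) powr (1 + \<eta>)"
    by (simp add: \<eta>_def field_simps flip: powr_add)
  also have "\<dots> = (1 - x) * (K * (1 - x) powr \<eta>)"
    using x by (simp add: powr_add)
  also have "\<dots> < (1 - x) * 1"
    using x by (intro mult_strict_left_mono) auto
  finally show ?thesis
    using x by auto
qed

lemma hyp2F1_nonneg: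
  assumes "a > 0" "b > 0" "c > 0" "0 \<le> x" "x < 1"
  shows "0 \<le> hyp2F1 a b c x"
  unfolding eval_hyp_fps[symmetric] eval_fps_def
  using hyp_fps_pos[OF assms(1-3)] hyp_fps_conv_radius[OF assms(1-3)] assms(4,5)
  by (intro suminf_nonneg summable_fps fps_conv_radius_ge_1D mult_nonneg_nonneg)
     (auto simp: less_imp_le)

text \<open>A concave function with value \<open>1\<close> at \<open>0\<close> that is nonnegative up to \<open>1\<close> lies above the line
  \<open>1 - x\<close>. The value at \<open>1\<close> is not at hand, so chords from \<open>0\<close> to \<open>z < 1\<close> are used and \<open>z\<close> tends
  to \<open>1\<close>.\<close>

lemma concave_calF_imp_exponent_le_1:
  assumes "a > 0" "b > 0" "c > 0" "c \<ge> a + b"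
    and concave: "\<And>x. x \<in> {0<..<1} \<Longrightarrow> (deriv ^^ 2) (calF a b c p) x \<le> 0"
  shows "p \<le> 1"
proof (rule ccontr)
  assume "\<not> p \<le> 1"
  then obtain x where x: "x \<in> {0<..<1}" "calF a b c p x < 1 - x"
    using calF_below_chord[OF assms(1-4), of p] by auto
  let ?A = "calF_fps a b c p"
  note rad = calF_fps_conv_radius[OF assms(1-3), of p]
  note eval = eval_calF_fps[OF assms(1-3)]
  have d2: "(deriv ^^ 2) (calF a b c p) x = eval_fps (fps_deriv (fps_deriv ?A)) x" if "\<bar>x\<bar> < 1" for x
    using funpow_deriv_eq_eval_fps[OF rad _ that, of "calF a b c p" 2] eval
    by (simp add: numeral_2_eq_2)
  have rad': "fps_conv_radius (fps_deriv ?A) \<ge> 1" "fps_conv_radius (fps_deriv (fps_deriv ?A)) \<ge> 1"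
    using order_trans[OF rad fps_conv_radius_deriv]
      order_trans[OF order_trans[OF rad fps_conv_radius_deriv] fps_conv_radius_deriv] .
  have "eval_fps (- fps_deriv (fps_deriv ?A)) y \<ge> 0" if "y \<in> {0<..<1}" for y
    using concave[OF that] d2[of y] that fps_conv_radius_ge_1D[OF rad'(2), of y]
    by (simp add: eval_fps_minus)
  then have "fps_nth (- fps_deriv (fps_deriv ?A)) 0 \<ge> 0"
    using rad' by (intro fps_nth_0_nonneg) auto
  then have at_0: "eval_fps (fps_deriv (fps_deriv ?A)) 0 \<le> 0"
    by (simp add: eval_fps_at_0)
  \<comment> \<open>The left endpoint is included because the chords below start at \<open>0\<close>.\<close>
  have conc: "concave_on {0..<1} (eval_fps ?A)"
  proof (rule f''_le0_imp_concave)
    fix y :: real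
    assume y: "y \<in> {0..<1}"
    then have y': "\<bar>y\<bar> < 1"
      by simp
    show "(eval_fps ?A has_real_derivative eval_fps (fps_deriv ?A) y) (at y)"
      by (intro has_field_derivative_eval_fps fps_conv_radius_ge_1D rad y')
    show "(eval_fps (fps_deriv ?A) has_real_derivative eval_fps (fps_deriv (fps_deriv ?A)) y) (at y)"
      by (intro has_field_derivative_eval_fps fps_conv_radius_ge_1D rad' y')
    show "eval_fps (fps_deriv (fps_deriv ?A)) y \<le> 0"
      using concave[of y] d2[OF y'] y at_0 by (cases "y = 0") auto
  qed simp
  have chord: "calF a b c p x \<ge> 1 - x / z" if z: "x < z" "z < 1" for z
  proof -
    have "eval_fps ?A ((1 - x / z) *\<^sub>R 0 + (x / z) *\<^sub>R z)
        \<ge> (1 - x / z) * eval_fps ?A 0 + (x / z) * eval_fps ?A z"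
      using x z by (intro concave_onD[OF conc]) auto
    moreover have "0 \<le> (x / z) * eval_fps ?A z"
      using x z hyp2F1_nonneg[OF assms(1-3), of z] by (simp add: eval calF_def)
    ultimately show ?thesis
      using x z by (simp add: eval eval_fps_at_0)
  qed
  have "((\<lambda>z. 1 - x / z) \<longlongrightarrow> 1 - x / 1) (at_left 1)"
    by (intro tendsto_intros) auto
  moreover have "eventually (\<lambda>z. 1 - x / z \<le> calF a b c p x) (at_left 1)"
    using eventually_at_left_real[of x 1] x by (auto elim!: eventually_mono intro: chord)
  ultimately have "1 - x / 1 \<le> calF a b c p x"
    by (rule tendsto_upperbound) simp
  then show False
    using x by simp
qed

theorem theorem1:
  fixes a b c p :: real
  assumes "a > 0" and "b > 0" and "c > 0" and "c \<ge> a + b"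
  shows "(absolutely_monotonic_on {0<..<1} (\<lambda>x. - deriv (calF a b c p) x)
            \<longleftrightarrow> a*b/c \<le> p \<and> p \<le> 1) \<and>
         (absolutely_monotonic_on {0<..<1} (\<lambda>x. - (deriv ^^ 2) (calF a b c p) x)
            \<longleftrightarrow> p_lower a b c \<le> p \<and> p \<le> 1) \<and>
         (p_upper a b c \<le> p \<and> p \<le> 2 \<longrightarrow>
            absolutely_monotonic_on {0<..<1} ((deriv ^^ 2) (calF a b c p)))"
proof -
  define A1 A2 where "A1 = fps_deriv (calF_fps a b c p)" and "A2 = fps_deriv A1"
  have A1_nth: "fps_nth A1 n = (n + 1) * fps_nth (calF_fps a b c p) (n + 1)" for n
    by (simp add: A1_def)
  have A2_nth: "fps_nth A2 n = (n + 1) * (n + 2) * fps_nth (calF_fps a b c p) (n + 2)" for n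
    by (simp add: A2_def A1_def algebra_simps)
  note rad = calF_fps_conv_radius[OF assms(1-3), of p]
  have rad1: "fps_conv_radius A1 \<ge> 1"
    unfolding A1_def by (rule order_trans[OF rad fps_conv_radius_deriv])
  have rad2: "fps_conv_radius A2 \<ge> 1"
    unfolding A2_def by (rule order_trans[OF rad1 fps_conv_radius_deriv])
  have d1: "- deriv (calF a b c p) x = eval_fps (- A1) x" if "\<bar>x\<bar> < 1" for x
    using funpow_deriv_eq_eval_fps[OF rad, of "calF a b c p" x 1] eval_calF_fps[OF assms(1-3)] that
      fps_conv_radius_ge_1D[OF rad1, of x]
    by (simp add: A1_def eval_fps_minus)
  have d2': "(deriv ^^ 2) (calF a b c p) x = eval_fps A2 x" if "x \<in> {0<..<1}" for x
    using funpow_deriv_eq_eval_fps[OF rad, of "calF a b c p" x 2] eval_calF_fps[OF assms(1-3)] that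
    by (simp add: A1_def A2_def numeral_2_eq_2)
  have d2: "- (deriv ^^ 2) (calF a b c p) x = eval_fps (- A2) x" if "x \<in> {0<..<1}" for x
    using d2'[OF that] fps_conv_radius_ge_1D[OF rad2, of x] that by (simp add: eval_fps_minus)
  note bounds = p_lower_upper_bounds[OF assms]
  have ab: "0 < a * b / c"
    using assms by simp
  have nonneg: "0 \<le> f x" if "absolutely_monotonic_on {0<..<1} f" "x \<in> {0<..<1}" for f x
    using that unfolding absolutely_monotonic_on_def by metis
  have "a * b / c \<le> p \<and> p \<le> 1" if am: "absolutely_monotonic_on {0<..<1} (\<lambda>x. - deriv (calF a b c p) x)"
  proof
    have "fps_nth (- A1) 0 \<ge> 0"
      using nonneg[OF am] rad1 d1 by (intro fps_nth_0_nonneg) auto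
    then show "a * b / c \<le> p"
      by (simp add: A1_nth calF_fps_1)
    show "p \<le> 1"
    proof (rule concave_calF_imp_exponent_le_1[OF assms])
      fix x :: real
      assume x: "x \<in> {0<..<1}"
      have "\<forall>k. \<forall>x\<in>{0<..<1}. 0 \<le> (deriv ^^ k) (\<lambda>x. - deriv (calF a b c p) x) x"
        using iffD1[OF absolutely_monotonic_on_open_iff[OF open_greaterThanLessThan] am] by blast
      then have "0 \<le> (deriv ^^ 1) (\<lambda>x. - deriv (calF a b c p) x) x"
        using x by blast
      also have "\<dots> = - (deriv ^^ 2) (calF a b c p) x"
        using funpow_deriv_eq_eval_fps[of "- A1" "\<lambda>x. - deriv (calF a b c p) x" x 1] rad1 d1 d2[OF x] x
        by (simp add: A2_def)
      finally show "(deriv ^^ 2) (calF a b c p) x \<le> 0"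
        by simp
    qed
  qed
  moreover have "absolutely_monotonic_on {0<..<1} (\<lambda>x. - deriv (calF a b c p) x)"
    if "a * b / c \<le> p" "p \<le> 1"
  proof -
    have "fps_nth (- A1) n \<ge> 0" for n
      using calF_fps_nonpos[OF assms, of p 0 "n + 1"] that ab
      by (simp add: A1_nth calF_fps_1 mult_le_0_iff)
    then have "absolutely_monotonic_on {0<..<1} (eval_fps (- A1))"
      using rad1 by (intro absolutely_monotonic_on_eval_fps) auto
    then show ?thesis
      using absolutely_monotonic_on_cong[of "{0<..<1}" "\<lambda>x. - deriv (calF a b c p) x" "eval_fps (- A1)"] d1
      by auto
  qed
  moreover have "p_lower a b c \<le> p \<and> p \<le> 1"
    if am: "absolutely_monotonic_on {0<..<1} (\<lambda>x. - (deriv ^^ 2) (calF a b c p) x)"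
  proof
    have "fps_nth (- A2) 0 \<ge> 0"
      using nonneg[OF am] rad2 d2 by (intro fps_nth_0_nonneg) auto
    then have "fps_nth (calF_fps a b c p) 2 \<le> 0"
      by (simp add: A2_nth numeral_2_eq_2)
    then have "(p - p_lower a b c) * (p - p_upper a b c) \<le> 0"
      using calF_fps_2[OF assms, of p] by linarith
    moreover show "p \<le> 1"
      using nonneg[OF am] by (intro concave_calF_imp_exponent_le_1[OF assms]) auto
    ultimately show "p_lower a b c \<le> p"
      using bounds ab by (simp add: mult_le_0_iff)
  qed
  moreover have "absolutely_monotonic_on {0<..<1} (\<lambda>x. - (deriv ^^ 2) (calF a b c p) x)"
    if "p_lower a b c \<le> p" "p \<le> 1"
  proof -
    have "(p - p_lower a b c) * (p - p_upper a b c) \<le> 0"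
      using that bounds ab by (intro mult_nonneg_nonpos) auto
    then have "fps_nth (calF_fps a b c p) 2 \<le> 0"
      using calF_fps_2[OF assms, of p] by simp
    then have "fps_nth (- A2) n \<ge> 0" for n
      using calF_fps_nonpos[OF assms, of p 1 "n + 2"] that bounds
      by (simp add: A2_nth numeral_2_eq_2 mult_le_0_iff)
    then have "absolutely_monotonic_on {0<..<1} (eval_fps (- A2))"
      using rad2 by (intro absolutely_monotonic_on_eval_fps) auto
    then show ?thesis
      using absolutely_monotonic_on_cong[of "{0<..<1}" "\<lambda>x. - (deriv ^^ 2) (calF a b c p) x" "eval_fps (- A2)"]
        d2 by auto
  qed
  moreover have "absolutely_monotonic_on {0<..<1} ((deriv ^^ 2) (calF a b c p))"
    if "p_upper a b c \<le> p" "p \<le> 2"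
  proof -
    have "fps_nth A2 n \<ge> 0" for n
      using calF_fps_nonneg_from_2[OF assms that, of "n + 2"] by (simp add: A2_nth)
    then have "absolutely_monotonic_on {0<..<1} (eval_fps A2)"
      using rad2 by (intro absolutely_monotonic_on_eval_fps) auto
    then show ?thesis
      using absolutely_monotonic_on_cong[of "{0<..<1}" "(deriv ^^ 2) (calF a b c p)" "eval_fps A2"] d2'
      by auto
  qed
  ultimately show ?thesis
    by blast
qed

end
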